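(* Let $n$ be a positive integer and let $A$ and $B$ be $n\times n$ (entrywise) non-negative real matrices. Then $$ \rho(A\circ B)\le \rho\big((A\circ A)(B\circ B)\big)^{1/2}\le \rho(AB). $$
   Context: A matrix is called non-negative if all its entries are real and $\ge 0$ (this is an entrywise condition, not positive semidefiniteness). The symbol $\circ$ denotes the Hadamard (entrywise) product, $(A\circ B)_{ij}=A_{ij}B_{ij}$, while juxtaposition denotes the ordinary matrix product. The spectral radius $\rho(A)$ of a square matrix $A$ is the largest modulus of its (complex) eigenvalues. *)

theory Defs
  imports "Jordan_Normal_Form.Spectral_Radius"
begin

text \<open>The dimensions of the result are those of the left factor, so the definition is
  meaningful only for two matrices of the same shape.\<close>

definition hadamard_mat :: "'a::times mat \<Rightarrow> 'a mat \<Rightarrow> 'a mat"  (infixl "\<odot>\<^sub>m" 70) where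
  "A \<odot>\<^sub>m B = mat (dim_row A) (dim_col A) (\<lambda>(i, j). A $$ (i, j) * B $$ (i, j))"

definition nonneg_mat :: "real mat \<Rightarrow> bool" where
  "nonneg_mat A \<longleftrightarrow> (\<forall>i < dim_row A. \<forall>j < dim_col A. 0 \<le> A $$ (i, j))"

text \<open>The eigenvalues of a real matrix are taken over the complex numbers. As a maximum of a
  set of moduli this is meaningful for square matrices of positive dimension.\<close>

definition real_spectral_radius :: "real mat \<Rightarrow> real"  ("\<rho>") where
  "\<rho> A = spectral_radius (map_mat complex_of_real A)"

end

theory Submission
  imports Defs "HOL-Analysis.Convex"
begin

text \<open>Both inequalities compare the spectral radii of matrices whose powers are comparable entry
  by entry. The bridge is the growth characterisation of the spectral radius: the entries of
  \<open>X\<^sup>k\<close> are \<open>O(r\<^sup>k)\<close> for every \<open>r > \<rho> X\<close>, and conversely such a bound with \<open>r > 0\<close> forces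
  \<open>\<rho> X \<le> r\<close>. Hence \<open>|X\<^sup>k|\<^sup>p \<le> |P\<^sup>k| \<circ> |Q\<^sup>k|\<close> entrywise for all \<open>k\<close> yields \<open>\<rho>(X)\<^sup>p \<le> \<rho>(P) \<rho>(Q)\<close>
  (\<open>spectral_radius_power_le_mult\<close>), so it suffices to find entrywise relations that are
  compatible with matrix products and therefore pass to powers. There are two.

  For non-negative \<open>P\<close>, \<open>Q\<close>, the relation \<open>X \<circ> X \<le> P \<circ> Q\<close> is compatible with products by the
  Cauchy-Schwarz inequality. It holds with equality for \<open>(A \<circ> B, A \<circ> A, B \<circ> B)\<close> and also with the
  last two matrices exchanged. Multiplying these two instances gives the relation for
  \<open>X = (A \<circ> B)\<^sup>2\<close>, \<open>P = (A \<circ> A)(B \<circ> B)\<close> and \<open>Q = (B \<circ> B)(A \<circ> A)\<close>. Since \<open>\<rho>(A \<circ> B)\<^sup>2 \<le> \<rho>(X)\<close> and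
  \<open>\<rho>(Q) \<le> \<rho>(P)\<close>, it follows that \<open>\<rho>(A \<circ> B)\<^sup>4 \<le> \<rho>(P)\<^sup>2\<close>, which is the first inequality. In terms of
  walks, the factors of a product of entries of \<open>A \<circ> B\<close> along a walk of even length are
  redistributed so that \<open>A\<close> and \<open>B\<close> alternate.

  For non-negative matrices, the relation \<open>X \<le> C \<circ> C\<close> is compatible with products because a sum
  of squares of non-negative numbers is at most the square of their sum. Multiplying the trivial
  instances \<open>(A \<circ> A, A)\<close> and \<open>(B \<circ> B, B)\<close> gives the relation for \<open>X = (A \<circ> A)(B \<circ> B)\<close> and
  \<open>C = A B\<close>, whence \<open>\<rho>(X) \<le> \<rho>(A B)\<^sup>2\<close>, which is the second inequality.\<close>

section \<open>Eigenvectors and the spectral radius\<close>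

lemma spectral_radius_attained:
  assumes A: "A \<in> carrier_mat n n" and n: "n > 0"
  obtains v l where "v \<in> carrier_vec n" "v \<noteq> 0\<^sub>v n"
    "map_mat complex_of_real A *\<^sub>v v = l \<cdot>\<^sub>v v" "norm l = \<rho> A"
proof -
  let ?A = "map_mat complex_of_real A"
  have cA: "?A \<in> carrier_mat n n" using A by simp
  from spectral_radius_mem_max(1)[OF cA n] obtain l where l: "l \<in> spectrum ?A"
    and nl: "norm l = spectral_radius ?A" by auto
  from l obtain v where "eigenvector ?A v l"
    unfolding spectrum_def eigenvalue_def by auto
  then show ?thesis using that[of v l] cA nl
    unfolding eigenvector_def real_spectral_radius_def by auto
qed

lemma norm_eigenvalue_le_spectral_radius:
  assumes A: "A \<in> carrier_mat n n" and n: "n > 0"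
    and v: "v \<in> carrier_vec n" "v \<noteq> 0\<^sub>v n" and ev: "map_mat complex_of_real A *\<^sub>v v = l \<cdot>\<^sub>v v"
  shows "norm l \<le> \<rho> A"
proof -
  let ?A = "map_mat complex_of_real A"
  have cA: "?A \<in> carrier_mat n n" using A by simp
  have "eigenvector ?A v l" unfolding eigenvector_def using cA v ev by auto
  then have "l \<in> spectrum ?A" unfolding spectrum_def eigenvalue_def by auto
  then show ?thesis unfolding real_spectral_radius_def
    by (intro spectral_radius_mem_max(2)[OF cA n]) auto
qed

lemma spectral_radius_nonneg:
  assumes A: "A \<in> carrier_mat n n" and n: "n > 0"
  shows "0 \<le> \<rho> A"
  by (rule spectral_radius_attained[OF A n]) (metis norm_ge_zero)

text \<open>If \<open>v\<close> is an eigenvector for the dominant eigenvalue \<open>l\<close>, then \<open>A (A v) = l\<^sup>2 v\<close>.\<close>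

lemma spectral_radius_square_le:
  assumes A: "A \<in> carrier_mat n n" and n: "n > 0"
  shows "\<rho> A ^ 2 \<le> \<rho> (A * A)"
proof (rule spectral_radius_attained[OF A n])
  fix v l assume v: "v \<in> carrier_vec n" "v \<noteq> 0\<^sub>v n"
    and ev: "map_mat complex_of_real A *\<^sub>v v = l \<cdot>\<^sub>v v" and l: "norm l = \<rho> A"
  let ?A = "map_mat complex_of_real A"
  have cA: "?A \<in> carrier_mat n n" using A by simp
  have "map_mat complex_of_real (A * A) *\<^sub>v v = ?A *\<^sub>v (?A *\<^sub>v v)"
    using assoc_mult_mat_vec[OF cA cA v(1)] of_real_hom.mat_hom_mult[OF A A] by metis
  also have "\<dots> = (l * l) \<cdot>\<^sub>v v"
    using mult_mat_vec[OF cA v(1)] by (simp add: ev smult_smult_assoc)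
  finally have "norm (l * l) \<le> \<rho> (A * A)"
    using A by (intro norm_eigenvalue_le_spectral_radius[OF _ n v]) auto
  then show ?thesis by (simp add: norm_mult l power2_eq_square)
qed

lemma mult_mat_vec_zero:
  fixes A :: "'a :: semiring_0 mat"
  assumes "A \<in> carrier_mat m n"
  shows "A *\<^sub>v 0\<^sub>v n = 0\<^sub>v m"
  using assms by (intro eq_vecI) (auto simp: scalar_prod_def)

text \<open>The matrix \<open>B\<close> carries an eigenvector \<open>v\<close> of \<open>A B\<close> to an eigenvector of \<open>B A\<close> for the same
  eigenvalue \<open>l\<close>, unless \<open>B v = 0\<close>, which can only happen if \<open>l = 0\<close>.\<close>

lemma spectral_radius_mult_commute_le:
  assumes A: "A \<in> carrier_mat n n" and B: "B \<in> carrier_mat n n" and n: "n > 0"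
  shows "\<rho> (A * B) \<le> \<rho> (B * A)"
proof -
  have AB: "A * B \<in> carrier_mat n n" and BA: "B * A \<in> carrier_mat n n" using A B by auto
  show ?thesis
  proof (rule spectral_radius_attained[OF AB n])
    fix v l assume v: "v \<in> carrier_vec n" "v \<noteq> 0\<^sub>v n"
      and ev: "map_mat complex_of_real (A * B) *\<^sub>v v = l \<cdot>\<^sub>v v" and l: "norm l = \<rho> (A * B)"
    let ?A = "map_mat complex_of_real A" and ?B = "map_mat complex_of_real B"
    have cA: "?A \<in> carrier_mat n n" and cB: "?B \<in> carrier_mat n n" using A B by auto
    let ?w = "?B *\<^sub>v v"
    have w: "?w \<in> carrier_vec n" using cB v by simp
    have ABv: "?A *\<^sub>v ?w = l \<cdot>\<^sub>v v"
      using ev assoc_mult_mat_vec[OF cA cB v(1)] of_real_hom.mat_hom_mult[OF A B] by metis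
    show ?thesis
    proof (cases "l = 0")
      case True
      then show ?thesis using l spectral_radius_nonneg[OF BA n] by simp
    next
      case False
      have "?w \<noteq> 0\<^sub>v n"
      proof
        assume "?w = 0\<^sub>v n"
        then have z: "l \<cdot>\<^sub>v v = 0\<^sub>v n" using mult_mat_vec_zero[OF cA] ABv by simp
        have "v = 0\<^sub>v n"
        proof (rule eq_vecI)
          fix i assume i: "i < dim_vec (0\<^sub>v n :: complex vec)"
          then have "(l \<cdot>\<^sub>v v) $ i = 0" using z by simp
          then show "v $ i = 0\<^sub>v n $ i" using i v(1) False by simp
        qed (use v in simp)
        then show False using v by simp
      qed
      moreover have "map_mat complex_of_real (B * A) *\<^sub>v ?w = l \<cdot>\<^sub>v ?w"
        using assoc_mult_mat_vec[OF cB cA w] of_real_hom.mat_hom_mult[OF B A]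
          mult_mat_vec[OF cB v(1)] ABv by metis
      ultimately have "norm l \<le> \<rho> (B * A)"
        by (intro norm_eigenvalue_le_spectral_radius[OF BA n w])
      then show ?thesis using l by simp
    qed
  qed
qed

section \<open>Spectral radius and growth of powers\<close>

lemma pow_smult_mat:
  fixes A :: "'a :: comm_semiring_1 mat"
  assumes A: "A \<in> carrier_mat n n"
  shows "(c \<cdot>\<^sub>m A) ^\<^sub>m k = c ^ k \<cdot>\<^sub>m (A ^\<^sub>m k)"
proof (induction k)
  case 0
  show ?case using A by auto
next
  case (Suc k)
  have "A ^\<^sub>m k \<in> carrier_mat n n" using A by simp
  then show ?case using A Suc
    by (simp add: mult_smult_distrib[of _ n n _ n] mult_smult_assoc_mat[of _ n n _ n])
      (auto simp: mult.assoc)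
qed

text \<open>The spectral radius of \<open>A / r\<close> is below 1, so the powers of \<open>A / r\<close> are bounded by the Jordan
  normal form.\<close>

lemma power_entries_bounded:
  assumes A: "A \<in> carrier_mat n n" and n: "n > 0" and r: "\<rho> A < r"
  obtains C where "C > 0" "\<And>k i j. i < n \<Longrightarrow> j < n \<Longrightarrow> \<bar>(A ^\<^sub>m k) $$ (i, j)\<bar> \<le> C * r ^ k"
proof -
  let ?A = "map_mat complex_of_real A"
  have cA: "?A \<in> carrier_mat n n" using A by simp
  have r0: "r > 0" using spectral_radius_nonneg[OF A n] r by simp
  let ?B = "complex_of_real (1 / r) \<cdot>\<^sub>m ?A"
  have cB: "?B \<in> carrier_mat n n" using cA by simp
  have "spectral_radius ?B < 1"
  proof -
    from spectral_radius_mem_max(1)[OF cB n] obtain l where l: "l \<in> spectrum ?B"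
      and nl: "norm l = spectral_radius ?B" by auto
    from l obtain v where v: "v \<in> carrier_vec n" "v \<noteq> 0\<^sub>v n" "?B *\<^sub>v v = l \<cdot>\<^sub>v v"
      using cB unfolding spectrum_def eigenvalue_def eigenvector_def by auto
    have "?A *\<^sub>v v = complex_of_real r \<cdot>\<^sub>v (?B *\<^sub>v v)"
      using v(1) cA r0 by (intro eq_vecI) (auto simp: scalar_prod_def sum_distrib_left)
    also have "\<dots> = (complex_of_real r * l) \<cdot>\<^sub>v v"
      unfolding v(3) by (simp add: smult_smult_assoc)
    finally have "norm (complex_of_real r * l) \<le> \<rho> A"
      by (rule norm_eigenvalue_le_spectral_radius[OF A n v(1,2)])
    then have "norm l \<le> \<rho> A / r" using r0 by (simp add: norm_mult pos_le_divide_eq mult.commute)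
    also have "\<dots> < 1" using r r0 by simp
    finally show ?thesis using nl by simp
  qed
  from spectral_radius_jnf_norm_bound_less_1_upper_triangular[OF cB this]
  obtain c where c: "\<And>k. norm_bound (?B ^\<^sub>m k) c" by auto
  show thesis
  proof (rule that[of "max c 1"])
    fix k i j assume ij: "i < n" "j < n"
    have Ak: "A ^\<^sub>m k \<in> carrier_mat n n" using A by simp
    have "?B ^\<^sub>m k = complex_of_real (1 / r) ^ k \<cdot>\<^sub>m map_mat complex_of_real (A ^\<^sub>m k)"
      using pow_smult_mat[OF cA] of_real_hom.mat_hom_pow[OF A] by metis
    then have "norm ((?B ^\<^sub>m k) $$ (i, j)) = \<bar>(A ^\<^sub>m k) $$ (i, j)\<bar> / r ^ k"
      using ij Ak r0 A by (simp add: norm_mult norm_power norm_divide power_divide)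
    moreover have "norm ((?B ^\<^sub>m k) $$ (i, j)) \<le> c"
      using c[of k] ij cB A unfolding norm_bound_def by (simp add: pow_mat_dim)
    ultimately show "\<bar>(A ^\<^sub>m k) $$ (i, j)\<bar> \<le> max c 1 * r ^ k"
      using r0 by (simp add: pos_divide_le_eq le_max_iff_disj max_mult_distrib_right)
  qed simp
qed

text \<open>Reading \<open>A\<^sup>k v = l\<^sup>k v\<close> in a coordinate where the dominant eigenvector \<open>v\<close> does not vanish
  shows that \<open>|l|\<^sup>k\<close> is at most a constant times \<open>r\<^sup>k\<close>, which is impossible for large \<open>k\<close> if
  \<open>|l| > r\<close>.\<close>

lemma spectral_radius_le_if_power_entries_bounded:
  assumes A: "A \<in> carrier_mat n n" and n: "n > 0" and r: "r > 0"
    and bnd: "\<And>k i j. i < n \<Longrightarrow> j < n \<Longrightarrow> \<bar>(A ^\<^sub>m k) $$ (i, j)\<bar> \<le> C * r ^ k"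
  shows "\<rho> A \<le> r"
proof (rule spectral_radius_attained[OF A n])
  fix v l assume v: "v \<in> carrier_vec n" "v \<noteq> 0\<^sub>v n"
    and ev: "map_mat complex_of_real A *\<^sub>v v = l \<cdot>\<^sub>v v" and l: "norm l = \<rho> A"
  let ?A = "map_mat complex_of_real A"
  have cA: "?A \<in> carrier_mat n n" using A by simp
  obtain i where i: "i < n" "v $ i \<noteq> 0" using v by (metis carrier_vecD eq_vecI index_zero_vec)
  define K where "K = C * (\<Sum>j<n. norm (v $ j)) / norm (v $ i)"
  have bound: "norm l ^ k \<le> K * r ^ k" for k
  proof -
    have Ak: "A ^\<^sub>m k \<in> carrier_mat n n" using A by simp
    have "?A ^\<^sub>m k *\<^sub>v v = l ^ k \<cdot>\<^sub>v v"
      using eigenvector_pow[OF cA, of v l k] cA v ev by (simp add: eigenvector_def)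
    then have "l ^ k * v $ i = (map_mat complex_of_real (A ^\<^sub>m k) *\<^sub>v v) $ i"
      using i v(1) of_real_hom.mat_hom_pow[OF A, of k] by (metis carrier_vecD index_smult_vec(1))
    also have "\<dots> = (\<Sum>j<n. complex_of_real ((A ^\<^sub>m k) $$ (i, j)) * v $ j)"
      using i v Ak A by (simp add: scalar_prod_def atLeast0LessThan)
    finally have "norm l ^ k * norm (v $ i)
        = norm (\<Sum>j<n. complex_of_real ((A ^\<^sub>m k) $$ (i, j)) * v $ j)"
      by (metis norm_mult norm_power)
    also have "\<dots> \<le> (\<Sum>j<n. \<bar>(A ^\<^sub>m k) $$ (i, j)\<bar> * norm (v $ j))"
      by (rule order_trans[OF norm_sum]) (simp add: norm_mult)
    also have "\<dots> \<le> (\<Sum>j<n. C * r ^ k * norm (v $ j))"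
      using bnd i by (intro sum_mono mult_right_mono) auto
    also have "\<dots> = C * r ^ k * (\<Sum>j<n. norm (v $ j))"
      by (simp add: sum_distrib_left)
    also have "\<dots> = K * r ^ k * norm (v $ i)"
      using i by (simp add: K_def)
    finally show ?thesis using i by simp
  qed
  show "\<rho> A \<le> r"
  proof (rule ccontr)
    assume "\<not> \<rho> A \<le> r"
    then have "1 < norm l / r" using l r by simp
    then obtain k where "K < (norm l / r) ^ k" using real_arch_pow by blast
    then show False using bound[of k] r by (simp add: power_divide pos_less_divide_eq)
  qed
qed

text \<open>If the entries of \<open>P\<^sup>k\<close> and \<open>Q\<^sup>k\<close> grow at most like \<open>r\<^sup>k\<close> and \<open>s\<^sup>k\<close>, then those of \<open>X\<^sup>k\<close> grow at
  most like the \<open>k\<close>-th power of the \<open>p\<close>-th root of \<open>r s\<close>; now let \<open>r\<close> and \<open>s\<close> decrease to the two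
  spectral radii. The exponents \<open>p = 2\<close> and \<open>p = 1\<close> serve the two halves of the theorem.\<close>

lemma spectral_radius_power_le_mult:
  assumes X: "X \<in> carrier_mat n n" and P: "P \<in> carrier_mat n n" and Q: "Q \<in> carrier_mat n n"
    and n: "n > 0" and p: "p > 0"
    and dom: "\<And>k i j. i < n \<Longrightarrow> j < n \<Longrightarrow>
      \<bar>(X ^\<^sub>m k) $$ (i, j)\<bar> ^ p \<le> \<bar>(P ^\<^sub>m k) $$ (i, j)\<bar> * \<bar>(Q ^\<^sub>m k) $$ (i, j)\<bar>"
  shows "\<rho> X ^ p \<le> \<rho> P * \<rho> Q"
proof -
  have less: "\<rho> X ^ p \<le> (\<rho> P + e) * (\<rho> Q + e)" if e: "e > 0" for e
  proof -
    define r s where "r = \<rho> P + e" and "s = \<rho> Q + e"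
    have rs: "r > 0" "s > 0"
      using e spectral_radius_nonneg[OF P n] spectral_radius_nonneg[OF Q n]
      by (auto simp: r_def s_def)
    have "\<rho> P < r" "\<rho> Q < s" using e by (auto simp: r_def s_def)
    from power_entries_bounded[OF P n this(1)] power_entries_bounded[OF Q n this(2)]
    obtain C D where C: "C > 0" "\<And>k i j. i < n \<Longrightarrow> j < n \<Longrightarrow> \<bar>(P ^\<^sub>m k) $$ (i, j)\<bar> \<le> C * r ^ k"
      and D: "D > 0" "\<And>k i j. i < n \<Longrightarrow> j < n \<Longrightarrow> \<bar>(Q ^\<^sub>m k) $$ (i, j)\<bar> \<le> D * s ^ k"
      by metis
    define t where "t = root p (r * s)"
    have t: "t > 0" "t ^ p = r * s" using rs p by (auto simp: t_def)
    have "\<rho> X \<le> t"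
    proof (rule spectral_radius_le_if_power_entries_bounded[OF X n t(1)])
      fix k i j assume ij: "i < n" "j < n"
      have "\<bar>(X ^\<^sub>m k) $$ (i, j)\<bar> ^ p \<le> (C * r ^ k) * (D * s ^ k)"
        using dom[OF ij, of k] C(2)[OF ij, of k] D(2)[OF ij, of k] C(1) rs
        by (meson abs_ge_zero less_imp_le mult_mono mult_nonneg_nonneg order_trans zero_le_power)
      also have "\<dots> = C * D * (t ^ p) ^ k" unfolding t(2) by (simp add: power_mult_distrib)
      also have "\<dots> = (root p (C * D) * t ^ k) ^ p"
        using C(1) D(1) p by (simp add: power_mult_distrib flip: power_mult) (simp add: mult.commute)
      finally show "\<bar>(X ^\<^sub>m k) $$ (i, j)\<bar> \<le> root p (C * D) * t ^ k"
        using C(1) D(1) t(1) p by (subst (asm) power_mono_iff) auto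
    qed
    then have "\<rho> X ^ p \<le> t ^ p" using spectral_radius_nonneg[OF X n] by (rule power_mono)
    then show ?thesis unfolding t(2) r_def s_def .
  qed
  have "((\<lambda>e. (\<rho> P + e) * (\<rho> Q + e)) \<longlongrightarrow> (\<rho> P + 0) * (\<rho> Q + 0)) (at_right 0)"
    by (intro tendsto_intros)
  moreover have "\<forall>\<^sub>F e in at_right 0. \<rho> X ^ p \<le> (\<rho> P + e) * (\<rho> Q + e)"
    by (rule eventually_mono[OF eventually_at_right_less less])
  ultimately show ?thesis
    using tendsto_lowerbound[OF _ _ trivial_limit_at_right_real] by fastforce
qed

section \<open>Entrywise comparisons compatible with products\<close>

lemma index_mult_mat_sum:
  assumes "A \<in> carrier_mat n n" "B \<in> carrier_mat n n" "i < n" "j < n"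
  shows "(A * B) $$ (i, j) = (\<Sum>k<n. A $$ (i, k) * B $$ (k, j))"
  using assms by (simp add: scalar_prod_def atLeast0LessThan)

lemma nonneg_mat_mult:
  assumes "A \<in> carrier_mat n n" "B \<in> carrier_mat n n" "nonneg_mat A" "nonneg_mat B"
  shows "nonneg_mat (A * B)"
  unfolding nonneg_mat_def
proof (intro allI impI)
  fix i j assume "i < dim_row (A * B)" "j < dim_col (A * B)"
  then have ij: "i < n" "j < n" using assms by auto
  show "0 \<le> (A * B) $$ (i, j)"
    unfolding index_mult_mat_sum[OF assms(1,2) ij]
    using assms ij by (intro sum_nonneg mult_nonneg_nonneg) (auto simp: nonneg_mat_def)
qed

text \<open>The entrywise relation \<open>X \<circ> X \<le> P \<circ> Q\<close> has to carry the non-negativity of \<open>P\<close> and \<open>Q\<close>, without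
  which it is not stable under products.\<close>

definition sq_le_hadamard :: "nat \<Rightarrow> real mat \<Rightarrow> real mat \<Rightarrow> real mat \<Rightarrow> bool" where
  "sq_le_hadamard n X P Q \<longleftrightarrow>
    X \<in> carrier_mat n n \<and> P \<in> carrier_mat n n \<and> Q \<in> carrier_mat n n \<and> nonneg_mat P \<and> nonneg_mat Q
    \<and> (\<forall>i<n. \<forall>j<n. X $$ (i, j) ^ 2 \<le> P $$ (i, j) * Q $$ (i, j))"

text \<open>Each summand of \<open>(X X')\<^sub>i\<^sub>j\<close> is bounded by the geometric mean of the corresponding summands of
  \<open>(P P')\<^sub>i\<^sub>j\<close> and \<open>(Q Q')\<^sub>i\<^sub>j\<close>, and the Cauchy-Schwarz inequality sums these geometric means.\<close>

lemma sq_le_hadamard_mult: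
  assumes "sq_le_hadamard n X P Q" "sq_le_hadamard n X' P' Q'"
  shows "sq_le_hadamard n (X * X') (P * P') (Q * Q')"
proof -
  note d = assms[unfolded sq_le_hadamard_def]
  have c: "X \<in> carrier_mat n n" "X' \<in> carrier_mat n n" "P \<in> carrier_mat n n"
    "P' \<in> carrier_mat n n" "Q \<in> carrier_mat n n" "Q' \<in> carrier_mat n n" using d by auto
  have "(X * X') $$ (i, j) ^ 2 \<le> (P * P') $$ (i, j) * (Q * Q') $$ (i, j)"
    if ij: "i < n" "j < n" for i j
  proof -
    let ?p = "\<lambda>k. P $$ (i, k) * P' $$ (k, j)" and ?q = "\<lambda>k. Q $$ (i, k) * Q' $$ (k, j)"
    have p: "?p k \<ge> 0" and q: "?q k \<ge> 0" if "k < n" for k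
      using d that ij by (auto simp: nonneg_mat_def)
    have summand: "\<bar>X $$ (i, k) * X' $$ (k, j)\<bar> \<le> sqrt (?p k) * sqrt (?q k)" if k: "k < n" for k
    proof -
      have "(X $$ (i, k) * X' $$ (k, j))\<^sup>2 = (X $$ (i, k))\<^sup>2 * (X' $$ (k, j))\<^sup>2"
        by (simp add: power_mult_distrib)
      also have "\<dots> \<le> (P $$ (i, k) * Q $$ (i, k)) * (P' $$ (k, j) * Q' $$ (k, j))"
        using d k ij by (intro mult_mono) (auto simp: nonneg_mat_def)
      finally have "(X $$ (i, k) * X' $$ (k, j))\<^sup>2 \<le> ?p k * ?q k" by (simp add: mult_ac)
      then show ?thesis by (metis real_sqrt_abs real_sqrt_le_mono real_sqrt_mult)
    qed
    have "\<bar>(X * X') $$ (i, j)\<bar> \<le> (\<Sum>k<n. sqrt (?p k) * sqrt (?q k))"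
      unfolding index_mult_mat_sum[OF c(1,2) ij]
      by (rule order_trans[OF sum_abs sum_mono]) (use summand in auto)
    then have "(X * X') $$ (i, j) ^ 2 \<le> (\<Sum>k<n. sqrt (?p k) * sqrt (?q k)) ^ 2"
      using power_mono[of "\<bar>(X * X') $$ (i, j)\<bar>" _ 2] by simp
    also have "\<dots> \<le> (\<Sum>k<n. sqrt (?p k) ^ 2) * (\<Sum>k<n. sqrt (?q k) ^ 2)"
      by (rule Cauchy_Schwarz_ineq_sum)
    also have "\<dots> = (\<Sum>k<n. ?p k) * (\<Sum>k<n. ?q k)"
      using p q by (intro arg_cong2[of _ _ _ _ "(*)"] sum.cong) auto
    finally show ?thesis
      by (simp only: index_mult_mat_sum[OF c(3,4) ij] index_mult_mat_sum[OF c(5,6) ij])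
  qed
  then show ?thesis using d nonneg_mat_mult c unfolding sq_le_hadamard_def by auto
qed

lemma sq_le_hadamard_pow:
  assumes "sq_le_hadamard n X P Q"
  shows "sq_le_hadamard n (X ^\<^sub>m k) (P ^\<^sub>m k) (Q ^\<^sub>m k)"
proof (induction k)
  case 0
  show ?case using assms by (auto simp: sq_le_hadamard_def nonneg_mat_def)
next
  case (Suc k)
  then show ?case using sq_le_hadamard_mult[OF Suc assms] by simp
qed

lemma spectral_radius_sq_le_mult:
  assumes "sq_le_hadamard n X P Q" and n: "n > 0"
  shows "\<rho> X ^ 2 \<le> \<rho> P * \<rho> Q"
proof (rule spectral_radius_power_le_mult[OF _ _ _ n])
  fix k i j assume ij: "i < n" "j < n"
  have "(X ^\<^sub>m k) $$ (i, j) ^ 2 \<le> (P ^\<^sub>m k) $$ (i, j) * (Q ^\<^sub>m k) $$ (i, j)"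
    using sq_le_hadamard_pow[OF assms(1), of k] ij unfolding sq_le_hadamard_def by blast
  also have "\<dots> \<le> \<bar>(P ^\<^sub>m k) $$ (i, j)\<bar> * \<bar>(Q ^\<^sub>m k) $$ (i, j)\<bar>"
    unfolding abs_mult[symmetric] by (rule abs_ge_self)
  finally show "\<bar>(X ^\<^sub>m k) $$ (i, j)\<bar> ^ 2 \<le> \<bar>(P ^\<^sub>m k) $$ (i, j)\<bar> * \<bar>(Q ^\<^sub>m k) $$ (i, j)\<bar>"
    unfolding power2_abs .
qed (use assms in \<open>auto simp: sq_le_hadamard_def\<close>)

text \<open>As above, non-negativity is part of the entrywise relation \<open>X \<le> C \<circ> C\<close> so that the relation
  is stable under products.\<close>

definition le_hadamard_sq :: "nat \<Rightarrow> real mat \<Rightarrow> real mat \<Rightarrow> bool" where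
  "le_hadamard_sq n X C \<longleftrightarrow>
    X \<in> carrier_mat n n \<and> C \<in> carrier_mat n n \<and> nonneg_mat X \<and> nonneg_mat C
    \<and> (\<forall>i<n. \<forall>j<n. X $$ (i, j) \<le> C $$ (i, j) ^ 2)"

lemma sum_squares_le_square_sum:
  fixes f :: "'a \<Rightarrow> real"
  assumes "finite I" "\<And>k. k \<in> I \<Longrightarrow> 0 \<le> f k"
  shows "(\<Sum>k\<in>I. f k ^ 2) \<le> (\<Sum>k\<in>I. f k) ^ 2"
  using assms
proof (induction I)
  case (insert a I)
  then have "0 \<le> 2 * f a * sum f I" by (simp add: sum_nonneg)
  then show ?case using insert by (simp add: power2_sum)
qed simp

lemma le_hadamard_sq_mult:
  assumes "le_hadamard_sq n X C" "le_hadamard_sq n X' C'"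
  shows "le_hadamard_sq n (X * X') (C * C')"
proof -
  note d = assms[unfolded le_hadamard_sq_def]
  have c: "X \<in> carrier_mat n n" "X' \<in> carrier_mat n n" "C \<in> carrier_mat n n"
    "C' \<in> carrier_mat n n" using d by auto
  have "(X * X') $$ (i, j) \<le> (C * C') $$ (i, j) ^ 2" if ij: "i < n" "j < n" for i j
  proof -
    have "(X * X') $$ (i, j) = (\<Sum>k<n. X $$ (i, k) * X' $$ (k, j))"
      by (rule index_mult_mat_sum[OF c(1,2) ij])
    also have "\<dots> \<le> (\<Sum>k<n. (C $$ (i, k) * C' $$ (k, j)) ^ 2)"
      unfolding power_mult_distrib
      using d ij by (intro sum_mono mult_mono) (auto simp: nonneg_mat_def)
    also have "\<dots> \<le> (\<Sum>k<n. C $$ (i, k) * C' $$ (k, j)) ^ 2"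
      using d ij by (intro sum_squares_le_square_sum) (auto simp: nonneg_mat_def)
    finally show ?thesis by (simp only: index_mult_mat_sum[OF c(3,4) ij])
  qed
  then show ?thesis using d nonneg_mat_mult c unfolding le_hadamard_sq_def by auto
qed

lemma le_hadamard_sq_pow:
  assumes "le_hadamard_sq n X C"
  shows "le_hadamard_sq n (X ^\<^sub>m k) (C ^\<^sub>m k)"
proof (induction k)
  case 0
  show ?case using assms by (auto simp: le_hadamard_sq_def nonneg_mat_def)
next
  case (Suc k)
  then show ?case using le_hadamard_sq_mult[OF Suc assms] by simp
qed

lemma spectral_radius_le_square:
  assumes "le_hadamard_sq n X C" and n: "n > 0"
  shows "\<rho> X \<le> \<rho> C ^ 2"
proof -
  have "\<rho> X ^ 1 \<le> \<rho> C * \<rho> C"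
  proof (rule spectral_radius_power_le_mult[OF _ _ _ n])
    fix k i j assume ij: "i < n" "j < n"
    have "0 \<le> (X ^\<^sub>m k) $$ (i, j)" "(X ^\<^sub>m k) $$ (i, j) \<le> (C ^\<^sub>m k) $$ (i, j) ^ 2"
      using le_hadamard_sq_pow[OF assms(1), of k] ij
      unfolding le_hadamard_sq_def nonneg_mat_def by (metis carrier_matD)+
    then show "\<bar>(X ^\<^sub>m k) $$ (i, j)\<bar> ^ 1 \<le> \<bar>(C ^\<^sub>m k) $$ (i, j)\<bar> * \<bar>(C ^\<^sub>m k) $$ (i, j)\<bar>"
      by (simp add: power2_eq_square)
  qed (use assms in \<open>auto simp: le_hadamard_sq_def\<close>)
  then show ?thesis by (simp add: power2_eq_square)
qed

section \<open>The two inequalities\<close>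

lemma hadamard_mat_carrier:
  "A \<in> carrier_mat n m \<Longrightarrow> A \<odot>\<^sub>m B \<in> carrier_mat n m"
  by (auto simp: hadamard_mat_def)

theorem theorem1:
  fixes n :: nat and A B :: "real mat"
  assumes "n > 0"
    and "A \<in> carrier_mat n n" and "B \<in> carrier_mat n n"
    and "nonneg_mat A" and "nonneg_mat B"
  shows "\<rho> (A \<odot>\<^sub>m B) \<le> sqrt (\<rho> ((A \<odot>\<^sub>m A) * (B \<odot>\<^sub>m B)))
    \<and> sqrt (\<rho> ((A \<odot>\<^sub>m A) * (B \<odot>\<^sub>m B))) \<le> \<rho> (A * B)"
proof (rule conjI)
  note n = assms(1)
  let ?AA = "A \<odot>\<^sub>m A" and ?BB = "B \<odot>\<^sub>m B" and ?M = "A \<odot>\<^sub>m B"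
  have c: "?AA \<in> carrier_mat n n" "?BB \<in> carrier_mat n n" "?M \<in> carrier_mat n n"
    by (rule hadamard_mat_carrier[OF assms(2)] hadamard_mat_carrier[OF assms(3)])+
  then have cm: "?AA * ?BB \<in> carrier_mat n n" "?BB * ?AA \<in> carrier_mat n n" "A * B \<in> carrier_mat n n"
    using assms by auto
  have AB: "sq_le_hadamard n ?M ?AA ?BB" and BA: "sq_le_hadamard n ?M ?BB ?AA"
    using assms by (auto simp: sq_le_hadamard_def hadamard_mat_def nonneg_mat_def power2_eq_square mult_ac)
  \<comment> \<open>Squaring \<open>A \<circ> B\<close> lets the two factors use the relation with the roles of \<open>A \<circ> A\<close> and \<open>B \<circ> B\<close>
    exchanged, so that these matrices get multiplied with each other.\<close>
  have "(\<rho> ?M ^ 2) ^ 2 \<le> \<rho> (?M * ?M) ^ 2"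
    by (rule power_mono[OF spectral_radius_square_le[OF c(3) n]]) simp
  also have "\<dots> \<le> \<rho> (?AA * ?BB) * \<rho> (?BB * ?AA)"
    by (rule spectral_radius_sq_le_mult[OF sq_le_hadamard_mult[OF AB BA] n])
  also have "\<dots> \<le> \<rho> (?AA * ?BB) ^ 2"
    unfolding power2_eq_square
    by (rule mult_left_mono[OF spectral_radius_mult_commute_le[OF c(2,1) n]
          spectral_radius_nonneg[OF cm(1) n]])
  finally have "\<rho> ?M ^ 2 \<le> \<rho> (?AA * ?BB)"
    by (rule power2_le_imp_le[OF _ spectral_radius_nonneg[OF cm(1) n]])
  then show "\<rho> ?M \<le> sqrt (\<rho> (?AA * ?BB))"
    by (rule real_le_rsqrt)
  have "le_hadamard_sq n ?AA A" "le_hadamard_sq n ?BB B"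
    using assms by (auto simp: le_hadamard_sq_def hadamard_mat_def nonneg_mat_def power2_eq_square)
  then have "\<rho> (?AA * ?BB) \<le> \<rho> (A * B) ^ 2"
    by (intro spectral_radius_le_square[OF _ n] le_hadamard_sq_mult)
  then show "sqrt (\<rho> (?AA * ?BB)) \<le> \<rho> (A * B)"
    by (rule real_le_lsqrt[OF spectral_radius_nonneg[OF cm(3) n]])
qed

end
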